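(* Let $X$ and $Y$ be connected, locally path-connected, semilocally simply connected spaces, let $f_1,\dots,f_k:X\to Y$ be maps with induced homomorphisms $\phi_1,\dots,\phi_k:\pi_1(X)\to\pi_1(Y)$, and suppose that $\pi_1(Y)$ is an abelian group. If $R(\phi_1,\ldots,\phi_k)<\infty$, then $R(\phi_1,\phi_j)<\infty$ for $j=2,\ldots,k$, and the product $R(\phi_1,\phi_2)\cdots R(\phi_1,\phi_k)$ divides $R(\phi_1,\ldots,\phi_k)$.
   Context: For homomorphisms $\phi_1,\dots,\phi_k:\pi_1(X)\to\pi_1(Y)$ ($k\ge2$), put on $\pi_1(Y)^{k-1}$ the equivalence relation $(\alpha_2,\dots,\alpha_k)\sim(\beta_2,\dots,\beta_k)$ iff there is $z\in\pi_1(X)$ with $\beta_i=\phi_1(z)\alpha_i\phi_i(z)^{-1}$ for all $i=2,\dots,k$. The quotient set is $\mathcal R(\phi_1,\dots,\phi_k)$ and its cardinality is the Reidemeister number $R(\phi_1,\dots,\phi_k)$. In particular $R(\phi_1,\phi_j)$ is the number of classes of $\pi_1(Y)$ under $\alpha\sim\phi_1(z)\alpha\phi_j(z)^{-1}$, $z\in\pi_1(X)$. *)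

theory Defs
  imports "HOL-Analysis.Analysis" "HOL-Algebra.Group"
begin

section \<open>Fundamental groups and induced homomorphisms\<close>

definition loops_at :: "'a::topological_space set \<Rightarrow> 'a \<Rightarrow> (real \<Rightarrow> 'a) set"
  where "loops_at S x = {p. path p \<and> path_image p \<subseteq> S \<and> pathstart p = x \<and> pathfinish p = x}"

definition loop_rel :: "'a::topological_space set \<Rightarrow> 'a \<Rightarrow> ((real \<Rightarrow> 'a) \<times> (real \<Rightarrow> 'a)) set"
  where "loop_rel S x = {(p, q). p \<in> loops_at S x \<and> q \<in> loops_at S x \<and> homotopic_paths S p q}"

text \<open>The constant path is written as a constant function because \<^const>\<open>linepath\<close>
  is available in normed spaces only.\<close>

definition fundamental_group :: "'a::topological_space set \<Rightarrow> 'a \<Rightarrow> (real \<Rightarrow> 'a) set monoid"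
  where "fundamental_group S x =
    \<lparr> carrier = loops_at S x // loop_rel S x,
      monoid.mult = (\<lambda>A B. \<Union>p\<in>A. \<Union>q\<in>B. loop_rel S x `` {p +++ q}),
      one = loop_rel S x `` {\<lambda>_. x} \<rparr>"

text \<open>The homomorphism from the fundamental group of \<open>X\<close> at \<open>x0\<close> to that of \<open>Y\<close> at \<open>y0\<close>
  induced by a map \<open>f\<close> is \<open>[p] \<mapsto> [w \<cdot> (f \<circ> p) \<cdot> w\<^sup>-\<^sup>1]\<close>, where \<open>w\<close> is a path in \<open>Y\<close>
  from \<open>y0\<close> to \<open>f x0\<close>.  Choosing \<open>w\<close> amounts to choosing a lift of \<open>f\<close> to the universal
  covers when fundamental groups are identified with groups of deck transformations.\<close>

definition induced_hom ::
    "'b::topological_space set \<Rightarrow> 'b \<Rightarrow> (real \<Rightarrow> 'b) \<Rightarrow> ('a::topological_space \<Rightarrow> 'b) \<Rightarrow>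
     (real \<Rightarrow> 'a) set \<Rightarrow> (real \<Rightarrow> 'b) set"
  where "induced_hom Y y0 w f A = (\<Union>p\<in>A. loop_rel Y y0 `` {w +++ (f \<circ> p) +++ reversepath w})"

definition semilocally_simply_connected :: "'a::topological_space set \<Rightarrow> bool"
  where "semilocally_simply_connected S \<longleftrightarrow>
    (\<forall>x\<in>S. \<exists>U. openin (top_of_set S) U \<and> x \<in> U \<and>
       (\<forall>p\<in>loops_at U x. homotopic_paths S p (\<lambda>_. x)))"

section \<open>Reidemeister classes\<close>

text \<open>Elements of the power of \<open>H\<close> indexed by \<open>2, \<dots>, k\<close> are functions that are
  \<^const>\<open>undefined\<close> off the index set.\<close>

definition reidemeister_rel ::
    "('g, 'm) monoid_scheme \<Rightarrow> ('h, 'n) monoid_scheme \<Rightarrow> nat \<Rightarrow> (nat \<Rightarrow> 'g \<Rightarrow> 'h) \<Rightarrow>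
     ((nat \<Rightarrow> 'h) \<times> (nat \<Rightarrow> 'h)) set"
  where "reidemeister_rel G H k \<phi> =
    {(\<alpha>, \<beta>). \<alpha> \<in> {2..k} \<rightarrow>\<^sub>E carrier H \<and> \<beta> \<in> {2..k} \<rightarrow>\<^sub>E carrier H \<and>
       (\<exists>z\<in>carrier G. \<forall>i\<in>{2..k}.
          \<beta> i = \<phi> 1 z \<otimes>\<^bsub>H\<^esub> \<alpha> i \<otimes>\<^bsub>H\<^esub> inv\<^bsub>H\<^esub> (\<phi> i z))}"

definition reidemeister_set ::
    "('g, 'm) monoid_scheme \<Rightarrow> ('h, 'n) monoid_scheme \<Rightarrow> nat \<Rightarrow> (nat \<Rightarrow> 'g \<Rightarrow> 'h) \<Rightarrow>
     (nat \<Rightarrow> 'h) set set"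
  where "reidemeister_set G H k \<phi> = ({2..k} \<rightarrow>\<^sub>E carrier H) // reidemeister_rel G H k \<phi>"

text \<open>Infinite Reidemeister numbers are represented by infinite Reidemeister sets, where
  \<^const>\<open>card\<close> is zero.\<close>

definition reidemeister_number ::
    "('g, 'm) monoid_scheme \<Rightarrow> ('h, 'n) monoid_scheme \<Rightarrow> nat \<Rightarrow> (nat \<Rightarrow> 'g \<Rightarrow> 'h) \<Rightarrow> nat"
  where "reidemeister_number G H k \<phi> = card (reidemeister_set G H k \<phi>)"

text \<open>The pair \<open>(\<phi>\<^sub>1, \<phi>\<^sub>j)\<close> as a family indexed by \<open>1, 2\<close>.\<close>

definition pair_family :: "(nat \<Rightarrow> 'c) \<Rightarrow> nat \<Rightarrow> nat \<Rightarrow> 'c"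
  where "pair_family \<phi> j = (\<lambda>i. if i = 1 then \<phi> 1 else \<phi> j)"

section \<open>Well-definedness\<close>

subsection \<open>The fundamental group is a group\<close>

text \<open>The unit and inverse laws for \<^const>\<open>homotopic_paths\<close> in the library are stated for
  normed spaces; here they are needed for arbitrary topological spaces.\<close>

lemma homotopic_paths_compose:
  fixes p :: "real \<Rightarrow> 'a::topological_space"
  assumes p: "path p" "path_image p \<subseteq> S"
    and c: "path c" "path_image c \<subseteq> {0..1}" and d: "path d" "path_image d \<subseteq> {0..1::real}"
    and ends: "pathstart d = pathstart c" "pathfinish d = pathfinish c"
  shows "homotopic_paths S (p \<circ> c) (p \<circ> d)"
proof (rule homotopic_paths_continuous_image)
  show "homotopic_paths {0..1} c d"
  proof (rule homotopic_paths_linear)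
    fix t :: real assume "t \<in> {0..1}"
    then have "c t \<in> {0..1}" "d t \<in> {0..1}"
      using c(2) d(2) unfolding path_image_def by blast+
    then show "closed_segment (c t) (d t) \<subseteq> {0..1}"
      by (simp add: closed_segment_subset)
  qed (use assms in auto)
  show "continuous_on {0..1} p" "p \<in> {0..1} \<rightarrow> S"
    using p by (auto simp: path_def path_image_def)
qed

lemma homotopic_paths_const_right:
  fixes p :: "real \<Rightarrow> 'a::topological_space"
  assumes "path p" "path_image p \<subseteq> S" "pathfinish p = x"
  shows "homotopic_paths S (p +++ (\<lambda>_. x)) p"
proof -
  have "homotopic_paths S (p \<circ> (linepath 0 1 +++ linepath 1 1)) (p \<circ> linepath 0 1)"
    using assms by (intro homotopic_paths_compose) (auto simp: path_image_join closed_segment_eq_real_ivl)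
  moreover have "p \<circ> linepath 0 1 = p" "p \<circ> linepath 1 1 = (\<lambda>_. x)"
    using assms by (auto simp: linepath_def pathfinish_def fun_eq_iff)
  ultimately show ?thesis by (simp add: path_compose_join)
qed

lemma homotopic_paths_const_left:
  fixes p :: "real \<Rightarrow> 'a::topological_space"
  assumes "path p" "path_image p \<subseteq> S" "pathstart p = x"
  shows "homotopic_paths S ((\<lambda>_. x) +++ p) p"
proof -
  have "homotopic_paths S (p \<circ> (linepath 0 0 +++ linepath 0 1)) (p \<circ> linepath 0 1)"
    using assms by (intro homotopic_paths_compose) (auto simp: path_image_join closed_segment_eq_real_ivl)
  moreover have "p \<circ> linepath 0 1 = p" "p \<circ> linepath 0 0 = (\<lambda>_. x)"
    using assms by (auto simp: linepath_def pathstart_def fun_eq_iff)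
  ultimately show ?thesis by (simp add: path_compose_join)
qed

lemma homotopic_paths_rev_right:
  fixes p :: "real \<Rightarrow> 'a::topological_space"
  assumes "path p" "path_image p \<subseteq> S" "pathstart p = x"
  shows "homotopic_paths S (p +++ reversepath p) (\<lambda>_. x)"
proof -
  have "homotopic_paths S (p \<circ> (linepath 0 1 +++ linepath 1 0)) (p \<circ> linepath 0 0)"
    using assms by (intro homotopic_paths_compose) (auto simp: path_image_join closed_segment_eq_real_ivl)
  moreover have "p \<circ> linepath 0 1 = p" "p \<circ> linepath 1 0 = reversepath p" "p \<circ> linepath 0 0 = (\<lambda>_. x)"
    using assms by (auto simp: linepath_def pathstart_def reversepath_def fun_eq_iff)
  ultimately show ?thesis by (simp add: path_compose_join)
qed

lemma homotopic_paths_rev_left: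
  fixes p :: "real \<Rightarrow> 'a::topological_space"
  assumes "path p" "path_image p \<subseteq> S" "pathfinish p = x"
  shows "homotopic_paths S (reversepath p +++ p) (\<lambda>_. x)"
  using homotopic_paths_rev_right[of "reversepath p" S x] assms by simp

lemma equiv_loop_rel: "equiv (loops_at S x) (loop_rel S x)"
  by (rule equivI) (auto simp: refl_on_def sym_def trans_def loop_rel_def loops_at_def
      intro: homotopic_paths_sym homotopic_paths_trans)

lemma loops_at_join: "p \<in> loops_at S x \<Longrightarrow> q \<in> loops_at S x \<Longrightarrow> p +++ q \<in> loops_at S x"
  by (auto simp: loops_at_def path_image_join)

lemma loops_at_const: "x \<in> S \<Longrightarrow> (\<lambda>_. x) \<in> loops_at S x"
  by (auto simp: loops_at_def path_def path_image_def pathstart_def pathfinish_def)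

lemma fundamental_group_mult:
  assumes "p \<in> loops_at S x" "q \<in> loops_at S x"
  shows "loop_rel S x `` {p} \<otimes>\<^bsub>fundamental_group S x\<^esub> loop_rel S x `` {q} = loop_rel S x `` {p +++ q}"
proof -
  have "congruent2 (loop_rel S x) (loop_rel S x) (\<lambda>p q. loop_rel S x `` {p +++ q})"
  proof (rule congruent2I')
    fix p p' q q' assume "(p, p') \<in> loop_rel S x" "(q, q') \<in> loop_rel S x"
    then have "(p +++ q, p' +++ q') \<in> loop_rel S x"
      by (auto simp: loop_rel_def loops_at_join homotopic_paths_join) (auto simp: loops_at_def intro: homotopic_paths_join)
    then show "loop_rel S x `` {p +++ q} = loop_rel S x `` {p' +++ q'}"
      by (rule equiv_class_eq[OF equiv_loop_rel])
  qed
  from UN_equiv_class2[OF equiv_loop_rel equiv_loop_rel this assms]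
  show ?thesis by (simp add: fundamental_group_def)
qed

lemma fundamental_group_carrierE:
  assumes "A \<in> carrier (fundamental_group S x)"
  obtains p where "p \<in> loops_at S x" "A = loop_rel S x `` {p}"
  using assms by (auto simp: fundamental_group_def elim: quotientE)

lemma fundamental_group_class:
  "p \<in> loops_at S x \<Longrightarrow> loop_rel S x `` {p} \<in> carrier (fundamental_group S x)"
  by (auto simp: fundamental_group_def quotientI)

lemma loop_classes_eq:
  assumes "p \<in> loops_at S x" "q \<in> loops_at S x" "homotopic_paths S p q"
  shows "loop_rel S x `` {p} = loop_rel S x `` {q}"
  using assms by (intro equiv_class_eq[OF equiv_loop_rel]) (simp add: loop_rel_def)

theorem group_fundamental_group:
  assumes "x \<in> S"
  shows "group (fundamental_group S x)"
proof (rule groupI)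
  let ?G = "fundamental_group S x"
  have one: "\<one>\<^bsub>?G\<^esub> = loop_rel S x `` {\<lambda>_. x}"
    by (simp add: fundamental_group_def)
  show "\<one>\<^bsub>?G\<^esub> \<in> carrier ?G"
    using assms by (simp add: one fundamental_group_class loops_at_const)
  fix A B C assume "A \<in> carrier ?G"
  then obtain p where p: "p \<in> loops_at S x" "A = loop_rel S x `` {p}"
    by (rule fundamental_group_carrierE)
  show "\<one>\<^bsub>?G\<^esub> \<otimes>\<^bsub>?G\<^esub> A = A"
  proof -
    have "homotopic_paths S ((\<lambda>_. x) +++ p) p"
      using p by (intro homotopic_paths_const_left) (auto simp: loops_at_def)
    then show ?thesis
      using p assms loop_classes_eq[of "(\<lambda>_. x) +++ p" S x p]
      by (simp add: one fundamental_group_mult loops_at_const loops_at_join)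
  qed
  have r: "reversepath p \<in> loops_at S x"
    using p by (auto simp: loops_at_def)
  show "\<exists>B\<in>carrier ?G. B \<otimes>\<^bsub>?G\<^esub> A = \<one>\<^bsub>?G\<^esub>"
  proof (rule bexI)
    have "homotopic_paths S (reversepath p +++ p) (\<lambda>_. x)"
      using p by (intro homotopic_paths_rev_left) (auto simp: loops_at_def)
    then show "loop_rel S x `` {reversepath p} \<otimes>\<^bsub>?G\<^esub> A = \<one>\<^bsub>?G\<^esub>"
      using p r assms loop_classes_eq[of "reversepath p +++ p" S x "\<lambda>_. x"]
      by (simp add: one fundamental_group_mult loops_at_const loops_at_join)
  qed (simp add: r fundamental_group_class)
  assume "B \<in> carrier ?G"
  then obtain q where q: "q \<in> loops_at S x" "B = loop_rel S x `` {q}"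
    by (rule fundamental_group_carrierE)
  show "A \<otimes>\<^bsub>?G\<^esub> B \<in> carrier ?G"
    using p q by (simp add: fundamental_group_mult fundamental_group_class loops_at_join)
  assume "C \<in> carrier ?G"
  then obtain r where r: "r \<in> loops_at S x" "C = loop_rel S x `` {r}"
    by (rule fundamental_group_carrierE)
  have "homotopic_paths S ((p +++ q) +++ r) (p +++ q +++ r)"
    using p q r by (intro homotopic_paths_sym[OF homotopic_paths_assoc]) (auto simp: loops_at_def)
  then show "A \<otimes>\<^bsub>?G\<^esub> B \<otimes>\<^bsub>?G\<^esub> C = A \<otimes>\<^bsub>?G\<^esub> (B \<otimes>\<^bsub>?G\<^esub> C)"
    using p q r loop_classes_eq[of "(p +++ q) +++ r" S x "p +++ q +++ r"]
    by (simp add: fundamental_group_mult loops_at_join)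
qed

subsection \<open>Induced maps are homomorphisms\<close>

lemma conjugate_loops_at:
  assumes "continuous_on X f" "f \<in> X \<rightarrow> Y"
    and "path w" "path_image w \<subseteq> Y" "pathstart w = y0" "pathfinish w = f x0" "p \<in> loops_at X x0"
  shows "w +++ (f \<circ> p) +++ reversepath w \<in> loops_at Y y0"
proof -
  have "path (f \<circ> p)" using assms by (intro path_continuous_image) (auto simp: loops_at_def intro: continuous_on_subset)
  then show ?thesis using assms
   by (auto simp: loops_at_def path_image_join path_image_compose pathstart_compose pathfinish_compose)
qed

lemma induced_hom_class:
  assumes "continuous_on X f" "f \<in> X \<rightarrow> Y"
    and "path w" "path_image w \<subseteq> Y" "pathstart w = y0" "pathfinish w = f x0" "p \<in> loops_at X x0"
  shows "induced_hom Y y0 w f (loop_rel X x0 `` {p}) = loop_rel Y y0 `` {w +++ (f \<circ> p) +++ reversepath w}"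
  unfolding induced_hom_def
proof (rule UN_equiv_class[OF equiv_loop_rel])
  show "(\<lambda>p. loop_rel Y y0 `` {w +++ (f \<circ> p) +++ reversepath w}) respects loop_rel X x0"
  proof (rule congruentI)
    fix p q assume pq: "(p, q) \<in> loop_rel X x0"
    then have "homotopic_paths Y (f \<circ> p) (f \<circ> q)"
      using assms by (auto simp: loop_rel_def intro: homotopic_paths_continuous_image)
    with pq assms show "loop_rel Y y0 `` {w +++ (f \<circ> p) +++ reversepath w} = loop_rel Y y0 `` {w +++ (f \<circ> q) +++ reversepath w}"
      by (intro loop_classes_eq conjugate_loops_at homotopic_paths_join)
         (auto simp: loop_rel_def loops_at_def pathstart_compose pathfinish_compose)
  qed
qed (use assms in auto)

theorem induced_hom_hom:
  assumes f: "continuous_on X f" "f \<in> X \<rightarrow> Y"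
    and w: "path w" "path_image w \<subseteq> Y" "pathstart w = y0" "pathfinish w = f x0"
  shows "induced_hom Y y0 w f \<in> hom (fundamental_group X x0) (fundamental_group Y y0)"
proof (rule homI)
  let ?c = "\<lambda>p. w +++ (f \<circ> p) +++ reversepath w"
  fix A assume "A \<in> carrier (fundamental_group X x0)"
  then obtain p where p: "p \<in> loops_at X x0" "A = loop_rel X x0 `` {p}"
    by (rule fundamental_group_carrierE)
  show "induced_hom Y y0 w f A \<in> carrier (fundamental_group Y y0)"
    using p conjugate_loops_at[OF f w p(1)] by (simp add: induced_hom_class[OF f w] fundamental_group_class)
  fix B assume "B \<in> carrier (fundamental_group X x0)"
  then obtain q where q: "q \<in> loops_at X x0" "B = loop_rel X x0 `` {q}"
    by (rule fundamental_group_carrierE)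
  define P Q R where "P = f \<circ> p" "Q = f \<circ> q" "R = reversepath w"
  have P: "path P" "path_image P \<subseteq> Y" "pathstart P = f x0" "pathfinish P = f x0"
   and Q: "path Q" "path_image Q \<subseteq> Y" "pathstart Q = f x0" "pathfinish Q = f x0"
   and R: "path R" "path_image R \<subseteq> Y" "pathstart R = f x0" "pathfinish R = y0"
    using p q f w unfolding P_Q_R_def
    by (auto simp: loops_at_def path_image_compose pathstart_compose pathfinish_compose
        intro!: path_continuous_image intro: continuous_on_subset)
  note [simp] = P Q R w path_image_join
  have "homotopic_paths Y ((w +++ P +++ R) +++ (w +++ Q +++ R)) (w +++ (P +++ R) +++ (w +++ Q +++ R))"
    by (intro homotopic_paths_sym[OF homotopic_paths_assoc]) auto
  also have "homotopic_paths Y \<dots> (w +++ P +++ R +++ w +++ Q +++ R)"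
    by (intro homotopic_paths_join homotopic_paths_sym[OF homotopic_paths_assoc]) auto
  also have "homotopic_paths Y \<dots> (w +++ P +++ (R +++ w) +++ Q +++ R)"
    by (intro homotopic_paths_join homotopic_paths_assoc) auto
  also have "homotopic_paths Y \<dots> (w +++ P +++ (\<lambda>_. f x0) +++ Q +++ R)"
  proof -
    have "homotopic_paths Y (R +++ w) (\<lambda>_. f x0)"
      unfolding P_Q_R_def using w by (intro homotopic_paths_rev_left) auto
    then show ?thesis by (intro homotopic_paths_join) auto
  qed
  also have "homotopic_paths Y \<dots> (w +++ P +++ Q +++ R)"
    by (intro homotopic_paths_join homotopic_paths_const_left) (auto simp: pathstart_def[of "\<lambda>_. f x0"])
  also have "homotopic_paths Y \<dots> (w +++ (P +++ Q) +++ R)"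
    by (intro homotopic_paths_join homotopic_paths_assoc) auto
  also have "P +++ Q = f \<circ> (p +++ q)" by (simp add: P_Q_R_def path_compose_join)
  finally have "homotopic_paths Y (?c (p +++ q)) (?c p +++ ?c q)"
    unfolding P_Q_R_def by (rule homotopic_paths_sym)
  then show "induced_hom Y y0 w f (A \<otimes>\<^bsub>fundamental_group X x0\<^esub> B) =
        induced_hom Y y0 w f A \<otimes>\<^bsub>fundamental_group Y y0\<^esub> induced_hom Y y0 w f B"
    using p q by (simp add: fundamental_group_mult induced_hom_class[OF f w] loops_at_join conjugate_loops_at[OF f w] loop_classes_eq)
qed

subsection \<open>The Reidemeister relation is an equivalence relation\<close>

theorem equiv_reidemeister_rel:
  assumes "group G" "group H" "k \<ge> 2" "\<And>i. i \<in> {1..k} \<Longrightarrow> \<phi> i \<in> hom G H"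
  shows "equiv ({2..k} \<rightarrow>\<^sub>E carrier H) (reidemeister_rel G H k \<phi>)"
proof -
  interpret G: group G by fact
  interpret H: group H by fact
  have hh: "group_hom G H (\<phi> i)" if "i \<in> {1..k}" for i
    using assms that by (simp add: group_hom_def group_hom_axioms_def)
  have c: "\<phi> i z \<in> carrier H" if "i \<in> {1..k}" "z \<in> carrier G" for i z
    using group_hom.hom_closed[OF hh] that by auto
  show ?thesis
  proof (rule equivI)
    show "reidemeister_rel G H k \<phi> \<subseteq> ({2..k} \<rightarrow>\<^sub>E carrier H) \<times> ({2..k} \<rightarrow>\<^sub>E carrier H)"
      by (auto simp: reidemeister_rel_def)
    show "refl_on ({2..k} \<rightarrow>\<^sub>E carrier H) (reidemeister_rel G H k \<phi>)"
    proof (rule refl_onI)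
      fix \<alpha> assume a: "\<alpha> \<in> {2..k} \<rightarrow>\<^sub>E carrier H"
      have "\<phi> i \<one>\<^bsub>G\<^esub> = \<one>\<^bsub>H\<^esub>" if "i \<in> {1..k}" for i using group_hom.hom_one[OF hh] that by auto
      with a assms(3) show "(\<alpha>, \<alpha>) \<in> reidemeister_rel G H k \<phi>"
        by (auto simp: reidemeister_rel_def PiE_iff intro!: bexI[of _ "\<one>\<^bsub>G\<^esub>"])
    qed
    show "sym (reidemeister_rel G H k \<phi>)"
    proof (rule symI)
      fix \<alpha> \<beta> assume "(\<alpha>, \<beta>) \<in> reidemeister_rel G H k \<phi>"
      then obtain z where z: "z \<in> carrier G" "\<alpha> \<in> {2..k} \<rightarrow>\<^sub>E carrier H" "\<beta> \<in> {2..k} \<rightarrow>\<^sub>E carrier H"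
        "\<And>i. i \<in> {2..k} \<Longrightarrow> \<beta> i = \<phi> 1 z \<otimes>\<^bsub>H\<^esub> \<alpha> i \<otimes>\<^bsub>H\<^esub> inv\<^bsub>H\<^esub> (\<phi> i z)" by (auto simp: reidemeister_rel_def)
      have "\<alpha> i = \<phi> 1 (inv\<^bsub>G\<^esub> z) \<otimes>\<^bsub>H\<^esub> \<beta> i \<otimes>\<^bsub>H\<^esub> inv\<^bsub>H\<^esub> (\<phi> i (inv\<^bsub>G\<^esub> z))" if i: "i \<in> {2..k}" for i
      proof -
        have [simp]: "\<alpha> i \<in> carrier H" "\<phi> 1 z \<in> carrier H" "\<phi> i z \<in> carrier H" using z i c by (auto simp del: One_nat_def)
        have "\<phi> 1 (inv\<^bsub>G\<^esub> z) = inv\<^bsub>H\<^esub> \<phi> 1 z" "\<phi> i (inv\<^bsub>G\<^esub> z) = inv\<^bsub>H\<^esub> \<phi> i z"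
          using group_hom.hom_inv[OF hh] i z by auto
        moreover have "inv\<^bsub>H\<^esub> \<phi> 1 z \<otimes>\<^bsub>H\<^esub> (\<phi> 1 z \<otimes>\<^bsub>H\<^esub> (\<alpha> i \<otimes>\<^bsub>H\<^esub> inv\<^bsub>H\<^esub> \<phi> i z) \<otimes>\<^bsub>H\<^esub> \<phi> i z) = \<alpha> i"
          by (simp add: H.m_assoc H.inv_solve_left' del: One_nat_def)
        ultimately show ?thesis using i z(4)[OF i] by (simp add: H.m_assoc del: One_nat_def)
      qed
      with z(1-3) show "(\<beta>, \<alpha>) \<in> reidemeister_rel G H k \<phi>"
        unfolding reidemeister_rel_def by (blast intro: G.inv_closed)
    qed
    show "trans (reidemeister_rel G H k \<phi>)"
    proof (rule transI)
      fix \<alpha> \<beta> \<gamma> assume "(\<alpha>, \<beta>) \<in> reidemeister_rel G H k \<phi>" "(\<beta>, \<gamma>) \<in> reidemeister_rel G H k \<phi>"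
      then obtain z y where z: "z \<in> carrier G" "y \<in> carrier G" "\<alpha> \<in> {2..k} \<rightarrow>\<^sub>E carrier H" "\<gamma> \<in> {2..k} \<rightarrow>\<^sub>E carrier H"
        "\<And>i. i \<in> {2..k} \<Longrightarrow> \<beta> i = \<phi> 1 z \<otimes>\<^bsub>H\<^esub> \<alpha> i \<otimes>\<^bsub>H\<^esub> inv\<^bsub>H\<^esub> (\<phi> i z)"
        "\<And>i. i \<in> {2..k} \<Longrightarrow> \<gamma> i = \<phi> 1 y \<otimes>\<^bsub>H\<^esub> \<beta> i \<otimes>\<^bsub>H\<^esub> inv\<^bsub>H\<^esub> (\<phi> i y)"
        by (auto simp: reidemeister_rel_def)
      have "\<gamma> i = \<phi> 1 (y \<otimes>\<^bsub>G\<^esub> z) \<otimes>\<^bsub>H\<^esub> \<alpha> i \<otimes>\<^bsub>H\<^esub> inv\<^bsub>H\<^esub> (\<phi> i (y \<otimes>\<^bsub>G\<^esub> z))" if i: "i \<in> {2..k}" for i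
      proof -
        have [simp]: "\<alpha> i \<in> carrier H" "\<phi> 1 z \<in> carrier H" "\<phi> i z \<in> carrier H" "\<phi> 1 y \<in> carrier H" "\<phi> i y \<in> carrier H" using z i c by (auto simp del: One_nat_def)
        have "\<phi> 1 (y \<otimes>\<^bsub>G\<^esub> z) = \<phi> 1 y \<otimes>\<^bsub>H\<^esub> \<phi> 1 z" "\<phi> i (y \<otimes>\<^bsub>G\<^esub> z) = \<phi> i y \<otimes>\<^bsub>H\<^esub> \<phi> i z"
          using group_hom.hom_mult[OF hh] i z by auto
        then show ?thesis using i z(5,6)[OF i] by (simp add: H.m_assoc H.inv_mult_group del: One_nat_def)
      qed
      with z(1-4) show "(\<alpha>, \<gamma>) \<in> reidemeister_rel G H k \<phi>"
        unfolding reidemeister_rel_def by (blast intro: G.m_closed)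
    qed
  qed
qed

end

theory Submission
  imports Defs "HOL-Algebra.Product_Groups"
begin

text \<open>When \<open>H\<close> is abelian, the Reidemeister classes of \<open>\<phi>\<^sub>1, \<dots>, \<phi>\<^sub>k\<close> are the cosets in
  \<open>H\<^sup>k\<^sup>-\<^sup>1\<close> of the image \<open>D\<close> of the homomorphism \<open>z \<mapsto> (\<phi>\<^sub>1(z) \<phi>\<^sub>i(z)\<^sup>-\<^sup>1)\<^sub>i\<close>.  If \<open>D\<^sub>i\<close> denotes the
  projection of \<open>D\<close> to the \<open>i\<close>-th factor, then \<open>D\<close> is contained in the product of the \<open>D\<^sub>i\<close>, so the
  quotient of \<open>H\<^sup>k\<^sup>-\<^sup>1\<close> by \<open>D\<close> maps onto the product of the groups \<open>H / D\<^sub>i\<close>, and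
  the order of a homomorphic image of a finite group divides the order of the group.\<close>

section \<open>Products of abelian groups and orders of homomorphic images\<close>

lemma comm_group_product_group:
  assumes "\<And>i. i \<in> I \<Longrightarrow> comm_group (G i)"
  shows "comm_group (product_group I G)"
proof (rule group.group_comm_groupI)
  show "group (product_group I G)"
    using assms by (intro product_group comm_group.axioms(2))
  fix x y assume "x \<in> carrier (product_group I G)" "y \<in> carrier (product_group I G)"
  then show "x \<otimes>\<^bsub>product_group I G\<^esub> y = y \<otimes>\<^bsub>product_group I G\<^esub> x"
    using assms by (auto simp: PiE_iff intro!: restrict_ext comm_monoid.m_comm comm_group.axioms(1))
qed

text \<open>By the first isomorphism theorem the image has as many elements as the kernel has
  cosets, and by Lagrange that number divides \<open>order G\<close>. An infinite \<open>G\<close>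
  has \<open>order\<close> 0, which every number divides.\<close>

lemma (in group_hom) order_dvd_if_surj:
  assumes "h ` carrier G = carrier H"
  shows "order H dvd order G"
proof -
  have "order H = card (rcosets kernel G H h)"
    using iso_same_card[OF FactGroup_iso[OF assms]] by (simp add: order_def FactGroup_def)
  then show ?thesis
    using G.lagrange[OF subgroup_kernel] by (metis dvd_triv_left)
qed

section \<open>The Reidemeister set as a quotient group\<close>

text \<open>In abelian \<open>H\<close>, \<open>z\<close> acts on tuples as multiplication by
  \<open>coincidence_map H k \<phi> z\<close>, so its image is the subgroup D of the overview. The
  restriction to \<open>{2..k}\<close> puts the values into the carrier of
  \<open>power_group H k\<close>.\<close>

definition coincidence_map ::
    "('h, 'n) monoid_scheme \<Rightarrow> nat \<Rightarrow> (nat \<Rightarrow> 'g \<Rightarrow> 'h) \<Rightarrow> 'g \<Rightarrow> nat \<Rightarrow> 'h"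
  where "coincidence_map H k \<phi> z = (\<lambda>i\<in>{2..k}. \<phi> 1 z \<otimes>\<^bsub>H\<^esub> inv\<^bsub>H\<^esub> (\<phi> i z))"

abbreviation power_group :: "('h, 'n) monoid_scheme \<Rightarrow> nat \<Rightarrow> (nat \<Rightarrow> 'h) monoid"
  where "power_group H k \<equiv> product_group {2..k} (\<lambda>_. H)"

text \<open>For index bound 2 and \<open>pair_family \<phi> j\<close> this is the group H / D_j of
  the overview, with elements of \<open>H\<close> encoded as functions on the one-point set
  \<open>{2..2}\<close>.\<close>

abbreviation reidemeister_group ::
    "('g, 'm) monoid_scheme \<Rightarrow> ('h, 'n) monoid_scheme \<Rightarrow> nat \<Rightarrow> (nat \<Rightarrow> 'g \<Rightarrow> 'h) \<Rightarrow>
     (nat \<Rightarrow> 'h) set monoid"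
  where "reidemeister_group G H k \<phi> \<equiv> power_group H k Mod (coincidence_map H k \<phi> ` carrier G)"

text \<open>Commutativity lets the four factors of the value at a product be regrouped into the
  value at \<open>y\<close> times the value at \<open>z\<close>.\<close>

lemma coincidence_map_hom:
  assumes "group G" "comm_group H" "\<And>i. i \<in> {1..k} \<Longrightarrow> \<phi> i \<in> hom G H" "k \<ge> 2"
  shows "coincidence_map H k \<phi> \<in> hom G (power_group H k)"
proof (rule homI)
  interpret H: comm_group H by fact
  have c: "\<phi> i z \<in> carrier H" if "i \<in> {1..k}" "z \<in> carrier G" for i z
    using assms(3)[OF that(1)] that(2) by (rule hom_in_carrier)
  have 1: "1 \<in> {1..k}" using assms(4) by simp
  show "coincidence_map H k \<phi> z \<in> carrier (power_group H k)" if "z \<in> carrier G" for z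
    using c[OF 1 that] c[OF _ that] by (auto simp: coincidence_map_def simp del: One_nat_def)
  fix y z assume yz: "y \<in> carrier G" "z \<in> carrier G"
  have "\<phi> 1 (y \<otimes>\<^bsub>G\<^esub> z) \<otimes>\<^bsub>H\<^esub> inv\<^bsub>H\<^esub> \<phi> i (y \<otimes>\<^bsub>G\<^esub> z) =
      (\<phi> 1 y \<otimes>\<^bsub>H\<^esub> inv\<^bsub>H\<^esub> \<phi> i y) \<otimes>\<^bsub>H\<^esub> (\<phi> 1 z \<otimes>\<^bsub>H\<^esub> inv\<^bsub>H\<^esub> \<phi> i z)" if i: "i \<in> {2..k}" for i
  proof -
    have i': "i \<in> {1..k}" using i by simp
    note [simp] = c[OF 1 yz(1)] c[OF 1 yz(2)] c[OF i' yz(1)] c[OF i' yz(2)]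
    show ?thesis
      using hom_mult[OF assms(3)[OF 1] yz] hom_mult[OF assms(3)[OF i'] yz]
      by (simp add: H.inv_mult H.m_ac del: One_nat_def)
  qed
  then show "coincidence_map H k \<phi> (y \<otimes>\<^bsub>G\<^esub> z) =
      coincidence_map H k \<phi> y \<otimes>\<^bsub>power_group H k\<^esub> coincidence_map H k \<phi> z"
    by (auto simp: coincidence_map_def intro!: restrict_ext simp del: One_nat_def)
qed

text \<open>The image of a homomorphism is a subgroup, and in an abelian group every subgroup is
  normal; this makes \<open>reidemeister_group\<close> a group.\<close>

lemma normal_coincidence_map_image:
  assumes "group G" "comm_group H" "\<And>i. i \<in> {1..k} \<Longrightarrow> \<phi> i \<in> hom G H" "k \<ge> 2"
  shows "(coincidence_map H k \<phi> ` carrier G) \<lhd> power_group H k"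
proof (rule comm_group.subgroup_imp_normal)
  show P: "comm_group (power_group H k)"
    using assms(2) by (rule comm_group_product_group)
  have "group_hom G (power_group H k) (coincidence_map H k \<phi>)"
    using assms(1) comm_group.axioms(2)[OF P] coincidence_map_hom[of G H k \<phi>, OF assms]
    by (simp add: group_hom_def group_hom_axioms_def)
  then show "subgroup (coincidence_map H k \<phi> ` carrier G) (power_group H k)"
    by (rule group_hom.img_is_subgroup)
qed

text \<open>Moving \<open>\<alpha> i\<close> past the other factors turns each class into a coset of
  D, so both sides are literally the same set of sets of functions.\<close>

lemma reidemeister_set_eq_carrier:
  assumes "group G" "comm_group H" "\<And>i. i \<in> {1..k} \<Longrightarrow> \<phi> i \<in> hom G H" "k \<ge> 2"
  shows "reidemeister_set G H k \<phi> = carrier (reidemeister_group G H k \<phi>)"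
proof -
  interpret H: comm_group H by fact
  have c: "\<phi> i z \<in> carrier H" if "i \<in> {1..k}" "z \<in> carrier G" for i z
    using assms(3)[OF that(1)] that(2) by (rule hom_in_carrier)
  have 1: "1 \<in> {1..k}" using assms(4) by simp
  have "reidemeister_rel G H k \<phi> `` {\<alpha>} = (coincidence_map H k \<phi> ` carrier G) #>\<^bsub>power_group H k\<^esub> \<alpha>"
    if \<alpha>: "\<alpha> \<in> {2..k} \<rightarrow>\<^sub>E carrier H" for \<alpha>
  proof -
    \<comment> \<open>The pointwise equations say nothing off \<open>{2..k}\<close>; membership in
      the function space forces \<open>\<beta>\<close> to be \<open>undefined\<close> there, as the
      restricted product on the right is.\<close>
    have "(\<beta> \<in> {2..k} \<rightarrow>\<^sub>E carrier H \<and> (\<forall>i\<in>{2..k}. \<beta> i = \<phi> 1 z \<otimes>\<^bsub>H\<^esub> \<alpha> i \<otimes>\<^bsub>H\<^esub> inv\<^bsub>H\<^esub> (\<phi> i z))) \<longleftrightarrow>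
        \<beta> = coincidence_map H k \<phi> z \<otimes>\<^bsub>power_group H k\<^esub> \<alpha>" if z: "z \<in> carrier G" for \<beta> z
    proof -
      let ?c = "\<lambda>i. \<phi> 1 z \<otimes>\<^bsub>H\<^esub> \<alpha> i \<otimes>\<^bsub>H\<^esub> inv\<^bsub>H\<^esub> (\<phi> i z)"
      have *: "\<phi> 1 z \<in> carrier H" "\<phi> i z \<in> carrier H" "\<alpha> i \<in> carrier H" if "i \<in> {2..k}" for i
        using c[OF 1 z] c[OF _ z] \<alpha> that by auto
      have "coincidence_map H k \<phi> z \<otimes>\<^bsub>power_group H k\<^esub> \<alpha> = restrict ?c {2..k}"
        using * by (auto simp: coincidence_map_def H.m_ac intro!: restrict_ext simp del: One_nat_def)
      moreover have "?c i \<in> carrier H" if "i \<in> {2..k}" for i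
        using *[OF that] by simp
      ultimately show ?thesis
        by (auto simp: PiE_iff fun_eq_iff extensional_def simp del: One_nat_def)
    qed
    then have "\<beta> \<in> reidemeister_rel G H k \<phi> `` {\<alpha>} \<longleftrightarrow>
        (\<exists>z\<in>carrier G. \<beta> = coincidence_map H k \<phi> z \<otimes>\<^bsub>power_group H k\<^esub> \<alpha>)" for \<beta>
      using \<alpha> unfolding reidemeister_rel_def by blast
    then show ?thesis
      by (auto simp: r_coset_def simp del: mult_product_group)
  qed
  then show ?thesis
    by (auto simp: reidemeister_set_def quotient_def carrier_FactGroup)
qed

section \<open>The surjection onto the product of the pairwise quotients\<close>

lemma pair_family_hom:
  assumes "\<And>i. i \<in> {1..k} \<Longrightarrow> \<phi> i \<in> hom G H" "j \<in> {2..k}"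
  shows "pair_family \<phi> j i \<in> hom G H"
proof -
  have "1 \<in> {1..k}" "j \<in> {1..k}" using assms(2) by auto
  then show ?thesis using assms(1) by (simp add: pair_family_def)
qed

text \<open>Sending a tuple to the family of cosets of its entries is a surjective homomorphism that
  kills D, so it factors through the quotient by D.\<close>

lemma reidemeister_group_surj:
  fixes H :: "('b, 'n) monoid_scheme"
  assumes G: "group G" and H: "comm_group H"
    and \<phi>: "\<And>i. i \<in> {1..k} \<Longrightarrow> \<phi> i \<in> hom G H" and k: "k \<ge> 2"
  obtains h where
    "group_hom (reidemeister_group G H k \<phi>)
       (product_group {2..k} (\<lambda>j. reidemeister_group G H 2 (pair_family \<phi> j))) h"
    "h ` carrier (reidemeister_group G H k \<phi>) =
       carrier (product_group {2..k} (\<lambda>j. reidemeister_group G H 2 (pair_family \<phi> j)))"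
proof -
  interpret H: comm_group H by fact
  let ?P = "power_group H k" and ?P2 = "power_group H 2"
  let ?D = "coincidence_map H k \<phi> ` carrier G"
  let ?D2 = "\<lambda>j. coincidence_map H 2 (pair_family \<phi> j) ` carrier G"
  let ?Q = "product_group {2..k} (\<lambda>j. reidemeister_group G H 2 (pair_family \<phi> j))"
  \<comment> \<open>\<open>\<sigma> j\<close> moves coordinate \<open>j\<close> to index 2, the only
    index of the power group used for a pair.\<close>
  define \<sigma> where "\<sigma> j \<alpha> = (\<lambda>i\<in>{2..2::nat}. \<alpha> j)" for j :: nat and \<alpha> :: "nat \<Rightarrow> 'b"
  define \<psi> where "\<psi> \<alpha> = (\<lambda>j\<in>{2..k}. ?D2 j #>\<^bsub>?P2\<^esub> \<sigma> j \<alpha>)" for \<alpha>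
  have D: "?D \<lhd> ?P"
    by (rule normal_coincidence_map_image[OF G H \<phi> k])
  have D2: "?D2 j \<lhd> ?P2" if "j \<in> {2..k}" for j
    by (rule normal_coincidence_map_image[OF G H pair_family_hom[OF \<phi> that]]) auto
  have Q: "group ?Q"
    by (intro product_group normal.factorgroup_is_group D2)
  have \<sigma>: "\<sigma> j \<alpha> \<in> carrier ?P2" if "j \<in> {2..k}" "\<alpha> \<in> carrier ?P" for j \<alpha>
    using that by (auto simp: \<sigma>_def)
  have \<sigma>_mult: "\<sigma> j (\<alpha> \<otimes>\<^bsub>?P\<^esub> \<beta>) = \<sigma> j \<alpha> \<otimes>\<^bsub>?P2\<^esub> \<sigma> j \<beta>" if "j \<in> {2..k}" for j \<alpha> \<beta>
    using that by (auto simp: \<sigma>_def fun_eq_iff)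
  have \<psi>_hom: "\<psi> \<in> hom ?P ?Q"
  proof (rule homI)
    show "\<psi> \<alpha> \<in> carrier ?Q" if "\<alpha> \<in> carrier ?P" for \<alpha>
      using \<sigma>[OF _ that] by (auto simp: \<psi>_def carrier_FactGroup simp del: carrier_product_group)
        (auto simp: carrier_FactGroup)
    show "\<psi> (\<alpha> \<otimes>\<^bsub>?P\<^esub> \<beta>) = \<psi> \<alpha> \<otimes>\<^bsub>?Q\<^esub> \<psi> \<beta>" if "\<alpha> \<in> carrier ?P" "\<beta> \<in> carrier ?P" for \<alpha> \<beta>
    proof -
      have "?D2 j #>\<^bsub>?P2\<^esub> \<sigma> j (\<alpha> \<otimes>\<^bsub>?P\<^esub> \<beta>) = (?D2 j #>\<^bsub>?P2\<^esub> \<sigma> j \<alpha>) <#>\<^bsub>?P2\<^esub> (?D2 j #>\<^bsub>?P2\<^esub> \<sigma> j \<beta>)"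
        if j: "j \<in> {2..k}" for j
        unfolding \<sigma>_mult[OF j]
        by (rule normal.rcos_sum[OF D2[OF j], symmetric]) (intro \<sigma> j \<open>\<alpha> \<in> _\<close> \<open>\<beta> \<in> _\<close>)+
      then show ?thesis
        unfolding \<psi>_def mult_product_group[of "{2..k}" "\<lambda>j. reidemeister_group G H 2 (pair_family \<phi> j)"]
        by (intro restrict_ext) (simp del: mult_product_group carrier_product_group)
    qed
  qed
  interpret \<psi>: group_hom ?P ?Q \<psi>
    using \<psi>_hom Q by (simp add: group_hom_def group_hom_axioms_def)
  \<comment> \<open>Entry \<open>j\<close> of \<open>coincidence_map H k \<phi> z\<close> is the
    sole entry of the coincidence map of the pair at the same \<open>z\<close>, so every component
    of \<open>\<psi> \<delta>\<close> is the trivial coset.\<close>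
  have \<psi>_D: "\<psi> \<delta> = \<one>\<^bsub>?Q\<^esub>" if \<delta>: "\<delta> \<in> ?D" for \<delta>
  proof -
    obtain z where z: "z \<in> carrier G" "\<delta> = coincidence_map H k \<phi> z"
      using \<delta> by blast
    have "?D2 j #>\<^bsub>?P2\<^esub> \<sigma> j \<delta> = ?D2 j" if j: "j \<in> {2..k}" for j
    proof -
      have "\<sigma> j \<delta> = coincidence_map H 2 (pair_family \<phi> j) z"
        using z j by (auto simp: \<sigma>_def coincidence_map_def pair_family_def fun_eq_iff)
      then have "\<sigma> j \<delta> \<in> ?D2 j" using z by blast
      then show ?thesis
        by (metis D2[OF j] normal_imp_subgroup subgroup.rcos_const normal.axioms(2))
    qed
    then show ?thesis
      by (auto simp: \<psi>_def fun_eq_iff simp del: mult_product_group)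
  qed
  \<comment> \<open>Constancy on cosets of D is what \<open>FactGroup_universal\<close> requires in
    order to factor \<open>\<psi>\<close>.\<close>
  have "\<psi> \<alpha> = \<psi> \<beta>" if \<alpha>: "\<alpha> \<in> carrier ?P" and \<beta>: "\<beta> \<in> carrier ?P"
    and eq: "?D #>\<^bsub>?P\<^esub> \<alpha> = ?D #>\<^bsub>?P\<^esub> \<beta>" for \<alpha> \<beta>
  proof -
    have "\<alpha> \<in> ?D #>\<^bsub>?P\<^esub> \<beta>"
      using eq \<psi>.G.rcos_self[OF \<alpha> normal_imp_subgroup[OF D]] by simp
    then obtain \<delta> where \<delta>: "\<delta> \<in> ?D" "\<alpha> = \<delta> \<otimes>\<^bsub>?P\<^esub> \<beta>"
      unfolding r_coset_def by blast
    then have "\<delta> \<in> carrier ?P"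
      using subgroup.mem_carrier[OF normal_imp_subgroup[OF D]] by blast
    then have "\<psi> \<alpha> = \<psi> \<delta> \<otimes>\<^bsub>?Q\<^esub> \<psi> \<beta>"
      using \<beta> \<delta>(2) \<psi>.hom_mult by metis
    then show ?thesis
      using \<psi>_D[OF \<delta>(1)] \<psi>.H.l_one[OF \<psi>.hom_closed[OF \<beta>]] by metis
  qed
  then obtain h where h: "h \<in> hom (?P Mod ?D) ?Q" "\<And>\<alpha>. \<alpha> \<in> carrier ?P \<Longrightarrow> h (?D #>\<^bsub>?P\<^esub> \<alpha>) = \<psi> \<alpha>"
    using FactGroup_universal[OF \<psi>_hom D] by blast
  have surj: "\<exists>\<alpha>\<in>carrier ?P. q = \<psi> \<alpha>" if q: "q \<in> carrier ?Q" for q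
  proof -
    have "\<exists>\<gamma>\<in>carrier ?P2. q j = ?D2 j #>\<^bsub>?P2\<^esub> \<gamma>" if "j \<in> {2..k}" for j
    proof -
      have "q j \<in> carrier (reidemeister_group G H 2 (pair_family \<phi> j))"
        using q that unfolding carrier_product_group[of "{2..k}"] by (rule PiE_mem)
      then show ?thesis
        unfolding carrier_FactGroup by blast
    qed
    then obtain \<gamma> where \<gamma>: "\<And>j. j \<in> {2..k} \<Longrightarrow> \<gamma> j \<in> carrier ?P2"
      "\<And>j. j \<in> {2..k} \<Longrightarrow> q j = ?D2 j #>\<^bsub>?P2\<^esub> \<gamma> j"
      by metis
    \<comment> \<open>Component \<open>j\<close> of \<open>\<psi>\<close> depends on entry
      \<open>j\<close> alone, so coset representatives \<open>\<gamma> j\<close> chosen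
      independently can be assembled into one tuple from their single entries at index 2.\<close>
    define \<alpha> where "\<alpha> = (\<lambda>j\<in>{2..k}. \<gamma> j 2)"
    have "\<alpha> \<in> carrier ?P"
      using \<gamma>(1) by (auto simp: \<alpha>_def PiE_iff)
    moreover have \<sigma>_\<alpha>: "\<sigma> j \<alpha> = \<gamma> j" if "j \<in> {2..k}" for j
      using \<gamma>(1)[OF that] that by (auto simp: \<sigma>_def \<alpha>_def fun_eq_iff PiE_iff extensional_def)
    have "q = \<psi> \<alpha>"
    proof (rule extensionalityI)
      show "q \<in> extensional {2..k}"
        using q by (simp add: PiE_iff)
      show "q j = \<psi> \<alpha> j" if "j \<in> {2..k}" for j
        using \<gamma>(2)[OF that] \<sigma>_\<alpha>[OF that] that by (simp add: \<psi>_def)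
    qed (simp add: \<psi>_def)
    ultimately show ?thesis by blast
  qed
  show thesis
  proof
    show gh: "group_hom (?P Mod ?D) ?Q h"
      using normal.factorgroup_is_group[OF D] Q h(1)
      by (simp add: group_hom_def group_hom_axioms_def)
    have "h ` carrier (?P Mod ?D) = \<psi> ` carrier ?P"
      unfolding carrier_FactGroup image_image using h(2) by (rule image_cong[OF refl])
    also have "\<dots> = carrier ?Q"
      using surj \<psi>.hom_closed by blast
    finally show "h ` carrier (?P Mod ?D) = carrier ?Q" .
  qed
qed

section \<open>Divisibility for groups and for fundamental groups\<close>

theorem reidemeister_prod_dvd:
  assumes G: "group G" and H: "comm_group H"
    and \<phi>: "\<And>i. i \<in> {1..k} \<Longrightarrow> \<phi> i \<in> hom G H" and k: "k \<ge> 2"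
    and fin: "finite (reidemeister_set G H k \<phi>)"
  shows "\<forall>j\<in>{2..k}. finite (reidemeister_set G H 2 (pair_family \<phi> j))"
    and "(\<Prod>j=2..k. reidemeister_number G H 2 (pair_family \<phi> j)) dvd reidemeister_number G H k \<phi>"
proof -
  let ?Q = "product_group {2..k} (\<lambda>j. reidemeister_group G H 2 (pair_family \<phi> j))"
  obtain h where h: "group_hom (reidemeister_group G H k \<phi>) ?Q h"
    "h ` carrier (reidemeister_group G H k \<phi>) = carrier ?Q"
    using reidemeister_group_surj[of G H k \<phi>, OF G H \<phi> k] by blast
  have R: "reidemeister_set G H k \<phi> = carrier (reidemeister_group G H k \<phi>)"
    by (rule reidemeister_set_eq_carrier[OF G H \<phi> k])
  have R2: "reidemeister_set G H 2 (pair_family \<phi> j) = carrier (reidemeister_group G H 2 (pair_family \<phi> j))"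
    if "j \<in> {2..k}" for j
    by (rule reidemeister_set_eq_carrier[OF G H pair_family_hom[OF \<phi> that]]) auto
  have Q: "carrier ?Q = (\<Pi>\<^sub>E j\<in>{2..k}. reidemeister_set G H 2 (pair_family \<phi> j))"
    unfolding carrier_product_group by (rule PiE_cong) (rule R2[symmetric])
  have "finite (carrier ?Q)"
    using fin h(2) by (metis R finite_imageI)
  \<comment> \<open>A product with an empty factor is finite whatever the other factors are;
    nonemptiness excludes this, so finiteness passes to every factor.\<close>
  moreover have "carrier ?Q \<noteq> {}"
    using h(1) by (metis empty_iff group.is_monoid group_hom.axioms(2) monoid.one_closed)
  ultimately show "\<forall>j\<in>{2..k}. finite (reidemeister_set G H 2 (pair_family \<phi> j))"
    unfolding Q by (simp add: finite_PiE_iff)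
  show "(\<Prod>j=2..k. reidemeister_number G H 2 (pair_family \<phi> j)) dvd reidemeister_number G H k \<phi>"
    using group_hom.order_dvd_if_surj[OF h]
    unfolding order_def Q by (simp add: card_PiE reidemeister_number_def R)
qed

theorem corollary1:
  fixes X :: "'a::topological_space set" and Y :: "'b::topological_space set"
    and f :: "nat \<Rightarrow> 'a \<Rightarrow> 'b" and w :: "nat \<Rightarrow> real \<Rightarrow> 'b" and k :: nat
    and \<phi> :: "nat \<Rightarrow> (real \<Rightarrow> 'a) set \<Rightarrow> (real \<Rightarrow> 'b) set"
    and x0 :: 'a and y0 :: 'b
  assumes "connected X" and "locally path_connected X" and "semilocally_simply_connected X"
    and "connected Y" and "locally path_connected Y" and "semilocally_simply_connected Y"
    and "x0 \<in> X" and "y0 \<in> Y"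
    and "k \<ge> 2"
    and "\<And>i. i \<in> {1..k} \<Longrightarrow> continuous_on X (f i) \<and> f i \<in> X \<rightarrow> Y"
    and "\<And>i. i \<in> {1..k} \<Longrightarrow>
           path (w i) \<and> path_image (w i) \<subseteq> Y \<and> pathstart (w i) = y0 \<and> pathfinish (w i) = f i x0"
    and "\<And>i. i \<in> {1..k} \<Longrightarrow> \<phi> i = induced_hom Y y0 (w i) (f i)"
    and "comm_group (fundamental_group Y y0)"
    and "finite (reidemeister_set (fundamental_group X x0) (fundamental_group Y y0) k \<phi>)"
  shows "(\<forall>j\<in>{2..k}. finite (reidemeister_set (fundamental_group X x0) (fundamental_group Y y0)
                        2 (pair_family \<phi> j))) \<and>
         (\<Prod>j=2..k. reidemeister_number (fundamental_group X x0) (fundamental_group Y y0)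
                        2 (pair_family \<phi> j))
           dvd reidemeister_number (fundamental_group X x0) (fundamental_group Y y0) k \<phi>"
proof -
  let ?G = "fundamental_group X x0" and ?H = "fundamental_group Y y0"
  \<comment> \<open>Conjugation by \<open>w i\<close> carries loops at \<open>f i x0\<close> to
    loops at \<open>y0\<close>, so all \<open>\<phi> i\<close> are homomorphisms between the same
    two groups.\<close>
  have hom: "\<phi> i \<in> hom ?G ?H" if "i \<in> {1..k}" for i
    using assms(10-12)[OF that] by (simp add: induced_hom_hom)
  note R = group_fundamental_group[OF assms(7)] assms(13) hom assms(9) assms(14)
  show ?thesis
    using reidemeister_prod_dvd[of ?G ?H k \<phi>, OF R] by blast
qed

end
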